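(* Let $\Omega=\prod_{i=1}^n\Omega_i$ be the product group of abelian groups $\Omega_i$, where either all $\Omega_i$ are finitely generated or all are vector spaces over a common infinite field $\mathbbm k$. Let $\lambda:\prod_{i=1}^n\mathscr B(\Omega_i)\to\mathbb Q[t_1,\dots,t_n]$ be the unique translation-invariant valuation on the Boolean algebra generated by products of cosets of subgroups of the $\Omega_i$ satisfying $\lambda(\prod_i A_i)=\prod_i\frac{|\mathrm{Tor}(\Omega_i)|}{|\mathrm{Tor}(\Omega_i/A_i)|}t_i^{\operatorname{rank}A_i}$ for subgroups $A_i\le\Omega_i$. Let $\mathcal A$ be a cartesian product arrangement of $\Omega$. Then \[ \chi(\mathcal A;t_1,\ldots,t_n)=\lambda\Big(\Omega-\bigcup_{A\in\mathcal A}A\Big). \]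
   Context: In the vector space case "subgroup" means linear subspace, rank means dimension and torsion is trivial; $\mathrm{Tor}(\Gamma)$ denotes the torsion subgroup. A cartesian product arrangement $\mathcal A$ of $\Omega$ is a finite collection of sets of the form $\prod_{i=1}^n F_i$, each $F_i$ a coset of a subgroup of $\Omega_i$. Its semilattice $L(\mathcal A)$ is the set of all non-empty intersections of members of $\mathcal A$, including the empty intersection, which is $\Omega$; it is partially ordered by inclusion and $\mu$ denotes its Möbius function. Each $X\in L(\mathcal A)$ is a product of cosets; $\pi_i:\Omega\to\Omega_i$ is the projection and $\pi_i\langle X\rangle$ denotes the subgroup of $\Omega_i$ of which $\pi_i(X)$ is a coset. The multivariable characteristic polynomial is \[ \chi(\mathcal A;t_1,\ldots,t_n)=\sum_{X\in L(\mathcal A)}\mu(X,\Omega)\prod_{i=1}^n\frac{|\mathrm{Tor}(\Omega_i)|}{|\mathrm{Tor}(\Omega_i/\pi_i\langle X\rangle)|}\,t_i^{\operatorname{rank}\pi_i\langle X\rangle}. \]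
   Formalization: The arrangement is additionally assumed not to contain Ω itself; for the arrangement {Ω} the identity fails, since χ is a nonzero monomial while λ(∅)=0. *)

theory Defs
  imports
    "HOL-Algebra.Product_Groups"
    "HOL-Library.Poly_Mapping"
    "HOL-Algebra.AbelCoset"
    "Jordan_Normal_Form.Missing_VectorSpace"
begin

text \<open>
  The two cases are carried by one type. The factors are always given as HOL-Algebra module
  records. In the case \<open>Groups\<close> only their additive structure is used; in the case
  \<open>Vector_Spaces K\<close> they are vector spaces over \<open>K\<close>.
\<close>

datatype 'r setting = Groups | Vector_Spaces 'r

definition fin_gen_abelian_group :: "('a, 'b) ring_scheme \<Rightarrow> bool" where
  "fin_gen_abelian_group M \<longleftrightarrow>
     abelian_group M \<and>
     (\<exists>S. finite S \<and> S \<subseteq> carrier M \<and> generate (add_monoid M) S = carrier M)"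

fun admissible_factors ::
  "('k, 'b) ring_scheme setting \<Rightarrow> nat \<Rightarrow> (nat \<Rightarrow> ('k, 'a, 'c) module_scheme) \<Rightarrow> bool" where
  "admissible_factors Groups n \<Omega> \<longleftrightarrow> (\<forall>i\<in>{1..n}. fin_gen_abelian_group (\<Omega> i))"
| "admissible_factors (Vector_Spaces K) n \<Omega> \<longleftrightarrow>
     field K \<and> infinite (carrier K) \<and> (\<forall>i\<in>{1..n}. vectorspace K (\<Omega> i))"

fun subgroups_of :: "('k, 'b) ring_scheme setting \<Rightarrow> ('k, 'a, 'c) module_scheme \<Rightarrow> 'a set set" where
  "subgroups_of Groups M = {H. subgroup H (add_monoid M)}"
| "subgroups_of (Vector_Spaces K) M = {H. subspace K H M}"

definition cosets_of :: "('k, 'b) ring_scheme setting \<Rightarrow> ('k, 'a, 'c) module_scheme \<Rightarrow> 'a set set" where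
  "cosets_of S M = {H +>\<^bsub>M\<^esub> x |H x. H \<in> subgroups_of S M \<and> x \<in> carrier M}"

definition torsion_subgroup :: "('a, 'b) monoid_scheme \<Rightarrow> 'a set" where
  "torsion_subgroup G = {x \<in> carrier G. \<exists>m::nat. m > 0 \<and> x [^]\<^bsub>G\<^esub> m = \<one>\<^bsub>G\<^esub>}"

text \<open>
  In the vector space case torsion is trivial by convention, also in positive characteristic,
  where the torsion subgroup of the underlying additive group is everything.
\<close>

fun torsion_order :: "'r setting \<Rightarrow> ('a, 'b) monoid_scheme \<Rightarrow> nat" where
  "torsion_order Groups G = card (torsion_subgroup G)"
| "torsion_order (Vector_Spaces K) G = 1"

definition int_independent :: "('a, 'b) monoid_scheme \<Rightarrow> 'a set \<Rightarrow> bool" where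
  "int_independent G B \<longleftrightarrow>
     (\<forall>c::'a \<Rightarrow> int. (\<Otimes>\<^bsub>G\<^esub>b\<in>B. b [^]\<^bsub>G\<^esub> c b) = \<one>\<^bsub>G\<^esub> \<longrightarrow> (\<forall>b\<in>B. c b = 0))"

text \<open>
  Rank of an abelian group: the largest number of elements that are linearly independent over
  the integers. The rank of a subspace is the library's dimension, which is an unspecified
  natural number if the subspace is not finite-dimensional.
\<close>

definition group_rank :: "('a, 'b) monoid_scheme \<Rightarrow> nat" where
  "group_rank G = Max {card B |B. finite B \<and> B \<subseteq> carrier G \<and> int_independent G B}"

fun rank_of :: "('k, 'b) ring_scheme setting \<Rightarrow> ('k, 'a, 'c) module_scheme \<Rightarrow> 'a set \<Rightarrow> nat" where
  "rank_of Groups M H = group_rank ((add_monoid M)\<lparr>carrier := H\<rparr>)"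
| "rank_of (Vector_Spaces K) M H = vectorspace.dim K (M\<lparr>carrier := H\<rparr>)"

text \<open>
  Polynomials over the rationals in variables indexed by the natural numbers: finitely supported maps from
  exponent vectors to coefficients.
\<close>

type_synonym rat_mpoly = "(nat \<Rightarrow>\<^sub>0 nat) \<Rightarrow>\<^sub>0 rat"

definition mvar :: "nat \<Rightarrow> rat_mpoly" where
  "mvar i = Poly_Mapping.single (Poly_Mapping.single i 1) 1"

definition mconst :: "rat \<Rightarrow> rat_mpoly" where
  "mconst c = Poly_Mapping.single 0 c"

definition mpolys :: "nat set \<Rightarrow> rat_mpoly set" where
  "mpolys I = {p. \<forall>m\<in>Poly_Mapping.keys p. Poly_Mapping.keys m \<subseteq> I}"

definition weight ::
  "('k, 'b) ring_scheme setting \<Rightarrow> nat \<Rightarrow> (nat \<Rightarrow> ('k, 'a, 'c) module_scheme) \<Rightarrow> (nat \<Rightarrow> 'a set)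
    \<Rightarrow> rat_mpoly" where
  "weight S n \<Omega> A =
     (\<Prod>i\<in>{1..n}.
        mconst (of_nat (torsion_order S (add_monoid (\<Omega> i))) /
                of_nat (torsion_order S (add_monoid (\<Omega> i) Mod A i)))
        * mvar i ^ rank_of S (\<Omega> i) (A i))"

definition total_group :: "nat \<Rightarrow> (nat \<Rightarrow> ('k, 'a, 'c) module_scheme) \<Rightarrow> (nat \<Rightarrow> 'a) monoid" where
  "total_group n \<Omega> = product_group {1..n} (\<lambda>i. add_monoid (\<Omega> i))"

definition coset_products ::
  "('k, 'b) ring_scheme setting \<Rightarrow> nat \<Rightarrow> (nat \<Rightarrow> ('k, 'a, 'c) module_scheme) \<Rightarrow> (nat \<Rightarrow> 'a) set set"
  where
  "coset_products S n \<Omega> = {PiE {1..n} C |C. \<forall>i\<in>{1..n}. C i \<in> cosets_of S (\<Omega> i)}"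

inductive_set boolean_algebra_gen :: "'x set \<Rightarrow> 'x set set \<Rightarrow> 'x set set"
  for U :: "'x set" and G :: "'x set set" where
  empty: "{} \<in> boolean_algebra_gen U G"
| gen: "A \<in> G \<Longrightarrow> A \<in> boolean_algebra_gen U G"
| union: "A \<in> boolean_algebra_gen U G \<Longrightarrow> B \<in> boolean_algebra_gen U G \<Longrightarrow>
    A \<union> B \<in> boolean_algebra_gen U G"
| compl: "A \<in> boolean_algebra_gen U G \<Longrightarrow> U - A \<in> boolean_algebra_gen U G"

definition valuation_on :: "'x set set \<Rightarrow> ('x set \<Rightarrow> 'y::ab_group_add) \<Rightarrow> bool" where
  "valuation_on \<B> v \<longleftrightarrow>
     v {} = 0 \<and> (\<forall>A\<in>\<B>. \<forall>B\<in>\<B>. v (A \<union> B) + v (A \<inter> B) = v A + v B)"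

definition translation_invariant_on ::
  "('x, 'b) monoid_scheme \<Rightarrow> 'x set set \<Rightarrow> ('x set \<Rightarrow> 'y) \<Rightarrow> bool" where
  "translation_invariant_on G \<B> v \<longleftrightarrow> (\<forall>A\<in>\<B>. \<forall>x\<in>carrier G. v (x <#\<^bsub>G\<^esub> A) = v A)"

definition is_char_valuation ::
  "('k, 'b) ring_scheme setting \<Rightarrow> nat \<Rightarrow> (nat \<Rightarrow> ('k, 'a, 'c) module_scheme)
    \<Rightarrow> ((nat \<Rightarrow> 'a) set \<Rightarrow> rat_mpoly) \<Rightarrow> bool" where
  "is_char_valuation S n \<Omega> v \<longleftrightarrow>
     (let \<B> = boolean_algebra_gen (carrier (total_group n \<Omega>)) (coset_products S n \<Omega>) in
        v \<in> \<B> \<rightarrow> mpolys {1..n} \<and>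
        valuation_on \<B> v \<and>
        translation_invariant_on (total_group n \<Omega>) \<B> v \<and>
        (\<forall>A. (\<forall>i\<in>{1..n}. A i \<in> subgroups_of S (\<Omega> i)) \<longrightarrow> v (PiE {1..n} A) = weight S n \<Omega> A))"

definition arrangement ::
  "('k, 'b) ring_scheme setting \<Rightarrow> nat \<Rightarrow> (nat \<Rightarrow> ('k, 'a, 'c) module_scheme)
    \<Rightarrow> (nat \<Rightarrow> 'a) set set \<Rightarrow> bool" where
  "arrangement S n \<Omega> \<A> \<longleftrightarrow> finite \<A> \<and> \<A> \<subseteq> coset_products S n \<Omega>"

definition intersection_semilattice :: "'x set \<Rightarrow> 'x set set \<Rightarrow> 'x set set" where
  "intersection_semilattice U \<A> = {U \<inter> \<Inter>\<C> |\<C>. \<C> \<subseteq> \<A>} - {{}}"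

text \<open>
  The Moebius function of a finite subset \<open>P\<close> of a partial order, for arguments in \<open>P\<close>. The case
  of infinite \<open>P\<close> is only there to make the recursion total.
\<close>

function mobius :: "'p::order set \<Rightarrow> 'p \<Rightarrow> 'p \<Rightarrow> int" where
  "mobius P x y =
     (if infinite P then 0
      else if x = y then 1
      else if x < y then - (\<Sum>z\<in>{z\<in>P. x \<le> z \<and> z < y}. mobius P x z)
      else 0)"
  by pat_completeness auto
termination
proof (relation "measure (\<lambda>(P, x, y). card {z\<in>P. z < y})", goal_cases)
  case (2 P x y z)
  then have "{w\<in>P. w < z} \<subset> {w\<in>P. w < y}"
    by (auto intro: less_trans)
  with 2 show ?case
    by (auto intro!: psubset_card_mono)
qed simp

declare mobius.simps [simp del]

definition direction ::
  "('k, 'b) ring_scheme setting \<Rightarrow> ('k, 'a, 'c) module_scheme \<Rightarrow> 'a set \<Rightarrow> 'a set" where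
  "direction S M C = (THE H. H \<in> subgroups_of S M \<and> (\<exists>x\<in>carrier M. C = H +>\<^bsub>M\<^esub> x))"

definition char_polynomial ::
  "('k, 'b) ring_scheme setting \<Rightarrow> nat \<Rightarrow> (nat \<Rightarrow> ('k, 'a, 'c) module_scheme)
    \<Rightarrow> (nat \<Rightarrow> 'a) set set \<Rightarrow> rat_mpoly" where
  "char_polynomial S n \<Omega> \<A> =
     (let U = carrier (total_group n \<Omega>); L = intersection_semilattice U \<A> in
        \<Sum>X\<in>L. of_int (mobius L X U) * weight S n \<Omega> (\<lambda>i. direction S (\<Omega> i) ((\<lambda>x. x i) ` X)))"

end

theory Submission
  imports Defs
begin

text \<open>
  Call the stratum of a flat \<open>X\<close> the set of those of its points that lie in no smaller flat. Every
  flat is the disjoint union of the strata of the flats below it, so that the valuation of a flat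
  is a sum of valuations of strata. Moebius inversion recovers the valuation of the top stratum,
  which is the complement of the arrangement because \<open>\<Omega>\<close> itself is not a member. By translation
  invariance the valuation of a flat is the weight of its direction.
\<close>

section \<open>Moebius inversion in a finite partial order\<close>

lemma mobius_self: "finite P \<Longrightarrow> mobius P x x = 1"
  by (subst mobius.simps) simp

text \<open>This is the defining recursion with all terms on one side: for \<open>x < y\<close> the
  value at \<open>y\<close> cancels the sum over the elements below it, and for \<open>x = y\<close>
  only the value 1 remains.\<close>

lemma sum_mobius_lower:
  assumes "finite P" "y \<in> P" "x \<le> y"
  shows "(\<Sum>z\<in>{z\<in>P. x \<le> z \<and> z \<le> y}. mobius P x z) = of_bool (x = y)"
proof (cases "x = y")
  case True
  then have "{z\<in>P. x \<le> z \<and> z \<le> y} = {y}"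
    using assms by auto
  with True show ?thesis
    by (simp add: mobius_self assms)
next
  case False
  then have "x < y" using assms by simp
  have "{z\<in>P. x \<le> z \<and> z \<le> y} = insert y {z\<in>P. x \<le> z \<and> z < y}"
    using assms by auto
  moreover have "mobius P x y = - (\<Sum>z\<in>{z\<in>P. x \<le> z \<and> z < y}. mobius P x z)"
    using \<open>x < y\<close> assms(1) by (subst mobius.simps) auto
  ultimately show ?thesis
    using False assms(1) by simp
qed

text \<open>
  The recursion defining the Moebius function says that it is a left inverse of the zeta function
  in the incidence algebra; a triangular left inverse is also a right inverse.
\<close>

lemma sum_mobius_upper:
  assumes "finite P" "y \<in> P" "x \<in> P" "x \<le> y"
  shows "(\<Sum>z\<in>{z\<in>P. x \<le> z \<and> z \<le> y}. mobius P z y) = of_bool (x = y)"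
  using assms(3,4)
\<comment> \<open>Counting the elements above \<open>x\<close> makes the induction run downwards, so
  that the claim is available at every point of the interval strictly above
  \<open>x\<close>.\<close>
proof (induction "card {z\<in>P. x < z}" arbitrary: x rule: less_induct)
  case less
  define h where "h w = (\<Sum>z\<in>{z\<in>P. w \<le> z \<and> z \<le> y}. mobius P z y)" for w
  let ?I = "{z\<in>P. x \<le> z \<and> z \<le> y}"
  have fin: "finite {z\<in>P. Q z}" for Q
    using assms(1) by simp
  have h_above: "h w = of_bool (w = y)" if "w \<in> P" "x < w" "w \<le> y" for w
  proof -
    have "{z\<in>P. w < z} \<subset> {z\<in>P. x < z}"
      using that by (auto intro: less_trans)
    then have "card {z\<in>P. w < z} < card {z\<in>P. x < z}"
      by (intro psubset_card_mono fin)
    then show ?thesis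
      using less.hyps that by (simp add: h_def)
  qed
  \<comment> \<open>The sum of \<open>mobius P x w * mobius P z y\<close> over all
    \<open>x \<le> w \<le> z \<le> y\<close> is evaluated twice. Here the sum over \<open>w\<close>
    is taken first: it vanishes unless \<open>z = x\<close>, which leaves
    \<open>mobius P x y\<close>.\<close>
  have "(\<Sum>w\<in>?I. mobius P x w * h w)
      = (\<Sum>w\<in>?I. \<Sum>z\<in>{z\<in>?I. w \<le> z}. mobius P x w * mobius P z y)"
    unfolding h_def sum_distrib_left
    by (intro sum.cong refl arg_cong2[where f = sum]) (auto intro: order_trans)
  also have "\<dots> = (\<Sum>z\<in>?I. \<Sum>w\<in>{w\<in>?I. w \<le> z}. mobius P x w * mobius P z y)"
    by (rule sum.swap_restrict) (use fin in auto)
  also have "\<dots> = (\<Sum>z\<in>?I. of_bool (x = z) * mobius P z y)"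
  proof (rule sum.cong[OF refl])
    fix z assume z: "z \<in> ?I"
    then have "{w\<in>?I. w \<le> z} = {w\<in>P. x \<le> w \<and> w \<le> z}"
      by (auto intro: order_trans)
    then show "(\<Sum>w\<in>{w\<in>?I. w \<le> z}. mobius P x w * mobius P z y) = of_bool (x = z) * mobius P z y"
      using sum_mobius_lower[OF assms(1), of z x] z by (simp flip: sum_distrib_right)
  qed
  also have "\<dots> = (\<Sum>z\<in>?I. if z = x then mobius P z y else 0)"
    by (intro sum.cong) auto
  also have "\<dots> = mobius P x y"
    using less.prems fin by simp
  finally have eq: "(\<Sum>w\<in>?I. mobius P x w * h w) = mobius P x y" .
  show ?case
  proof (cases "x = y")
    case True
    then have "?I = {y}" using assms by auto
    with True show ?thesis by (simp add: mobius_self assms)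
  next
    case False
    \<comment> \<open>With the sum over \<open>z\<close> taken first, \<open>h\<close> vanishes
      strictly between \<open>x\<close> and \<open>y\<close> and is 1 at \<open>y\<close>. The total
      is then \<open>h x + mobius P x y\<close>, and comparison with the first evaluation gives
      \<open>h x = 0\<close>.\<close>
    have "(\<Sum>w\<in>?I. mobius P x w * h w) = (\<Sum>w\<in>{x, y}. mobius P x w * h w)"
      by (intro sum.mono_neutral_right) (use fin assms less.prems h_above in auto)
    also have "\<dots> = h x + mobius P x y"
      using False h_above[of y] assms less.prems by (simp add: mobius_self)
    finally show ?thesis
      using eq False by (simp add: h_def)
  qed
qed

text \<open>Once \<open>g\<close> is expanded and the sums are exchanged, the coefficient of
  \<open>f z\<close> is the sum of \<open>mobius P x y\<close> over
  \<open>z \<le> x \<le> y\<close>, which is 0 unless \<open>z = y\<close>.\<close>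

lemma mobius_inversion_above:
  fixes f g :: "'p::order \<Rightarrow> 'r::comm_ring_1"
  assumes "finite P" "y \<in> P"
    and g: "\<And>x. x \<in> P \<Longrightarrow> g x = (\<Sum>z\<in>{z\<in>P. z \<le> x}. f z)"
  shows "(\<Sum>x\<in>{x\<in>P. x \<le> y}. of_int (mobius P x y) * g x) = f y"
proof -
  let ?I = "{x\<in>P. x \<le> y}"
  have fin: "finite ?I"
    using assms by simp
  have "(\<Sum>x\<in>?I. of_int (mobius P x y) * g x)
      = (\<Sum>x\<in>?I. \<Sum>z\<in>{z\<in>?I. z \<le> x}. of_int (mobius P x y) * f z)"
    unfolding sum_distrib_left[symmetric]
    by (intro sum.cong refl arg_cong2[where f = "(*)"])
      (auto simp: g intro!: sum.cong intro: order_trans)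
  also have "\<dots> = (\<Sum>z\<in>?I. \<Sum>x\<in>{x\<in>?I. z \<le> x}. of_int (mobius P x y) * f z)"
    by (rule sum.swap_restrict) (use fin in auto)
  also have "\<dots> = (\<Sum>z\<in>?I. if z = y then f z else 0)"
  proof (rule sum.cong[OF refl])
    fix z assume z: "z \<in> ?I"
    have "{x\<in>?I. z \<le> x} = {x\<in>P. z \<le> x \<and> x \<le> y}"
      by auto
    then have "(\<Sum>x\<in>{x\<in>?I. z \<le> x}. of_int (mobius P x y) * f z)
        = of_int (\<Sum>x\<in>{x\<in>P. z \<le> x \<and> x \<le> y}. mobius P x y) * f z"
      by (simp add: sum_distrib_right)
    also have "(\<Sum>x\<in>{x\<in>P. z \<le> x \<and> x \<le> y}. mobius P x y) = of_bool (z = y)"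
      using z by (intro sum_mobius_upper assms(1,2)) auto
    finally show "(\<Sum>x\<in>{x\<in>?I. z \<le> x}. of_int (mobius P x y) * f z) = (if z = y then f z else 0)"
      by simp
  qed
  also have "\<dots> = f y"
    using fin assms by simp
  finally show ?thesis .
qed

section \<open>Generated Boolean algebras and finite additivity\<close>

lemma boolean_algebra_gen_subset:
  assumes "\<Union>G \<subseteq> U" "A \<in> boolean_algebra_gen U G"
  shows "A \<subseteq> U"
  using assms(2) by induction (use assms(1) in auto)

lemma boolean_algebra_gen_Diff:
  assumes "\<Union>G \<subseteq> U" "A \<in> boolean_algebra_gen U G" "B \<in> boolean_algebra_gen U G"
  shows "A - B \<in> boolean_algebra_gen U G"
proof -
  have "A - B = U - ((U - A) \<union> B)"
    using boolean_algebra_gen_subset[OF assms(1,2)] by auto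
  then show ?thesis
    using assms by (auto intro: boolean_algebra_gen.intros)
qed

lemma boolean_algebra_gen_Union:
  assumes "finite \<F>" "\<F> \<subseteq> boolean_algebra_gen U G"
  shows "\<Union>\<F> \<in> boolean_algebra_gen U G"
  using assms by induction (auto intro: boolean_algebra_gen.intros)

text \<open>Intersecting with \<open>U\<close> gives the empty family the value \<open>U\<close>,
  which is the form of the elements of \<open>intersection_semilattice\<close>. The proof is De
  Morgan's law.\<close>

lemma boolean_algebra_gen_Inter:
  assumes "\<Union>G \<subseteq> U" "finite \<F>" "\<F> \<subseteq> boolean_algebra_gen U G"
  shows "U \<inter> \<Inter>\<F> \<in> boolean_algebra_gen U G"
proof -
  have "U \<inter> \<Inter>\<F> = U - \<Union>((-) U ` \<F>)"
    by auto
  also have "\<dots> \<in> boolean_algebra_gen U G"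
  proof (rule boolean_algebra_gen.compl, rule boolean_algebra_gen_Union)
    show "(-) U ` \<F> \<subseteq> boolean_algebra_gen U G"
      using assms(3) by (auto intro: boolean_algebra_gen.compl)
  qed (use assms(2) in simp)
  finally show ?thesis .
qed

text \<open>Each set split off is disjoint from the union of the remaining ones, so the intersection
  term of the valuation identity is \<open>v {} = 0\<close>.\<close>

lemma valuation_disjoint_UN:
  assumes v: "valuation_on (boolean_algebra_gen U G) v"
    and "finite I" "F ` I \<subseteq> boolean_algebra_gen U G" "disjoint_family_on F I"
  shows "v (\<Union>i\<in>I. F i) = (\<Sum>i\<in>I. v (F i))"
  using assms(2-)
proof induction
  case empty
  then show ?case using v by (simp add: valuation_on_def)
next
  case (insert j I)
  let ?W = "\<Union>i\<in>I. F i"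
  have "F j \<inter> ?W = {}"
    using insert.prems(2) insert.hyps(2) by (fastforce simp: disjoint_family_on_def)
  moreover have "?W \<in> boolean_algebra_gen U G"
    using insert by (intro boolean_algebra_gen_Union) auto
  moreover have "F j \<in> boolean_algebra_gen U G"
    using insert by auto
  ultimately have "v (F j \<union> ?W) = v (F j) + v ?W"
    using v unfolding valuation_on_def by (metis add.right_neutral)
  moreover have "v ?W = (\<Sum>i\<in>I. v (F i))"
    using insert by (auto simp: disjoint_family_on_def)
  ultimately show ?case
    using insert by simp
qed

section \<open>Strata of the flats\<close>

definition stratum :: "'x set set \<Rightarrow> 'x set \<Rightarrow> 'x set" where
  "stratum L X = X - \<Union>{Y\<in>L. Y \<subset> X}"

lemma finite_intersection_semilattice:
  "finite \<A> \<Longrightarrow> finite (intersection_semilattice U \<A>)"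
  unfolding intersection_semilattice_def
  by (rule finite_Diff, rule finite_subset[of _ "(\<lambda>\<C>. U \<inter> \<Inter>\<C>) ` Pow \<A>"]) auto

text \<open>The intersection of all members of the arrangement through \<open>x\<close> lies in
  every flat through \<open>x\<close>. The stratum of this least flat is the only one that contains
  \<open>x\<close>.\<close>

lemma intersection_semilattice_least:
  assumes "x \<in> U"
  obtains M where "M \<in> intersection_semilattice U \<A>" "x \<in> M"
    "\<And>Y. Y \<in> intersection_semilattice U \<A> \<Longrightarrow> x \<in> Y \<Longrightarrow> M \<subseteq> Y"
proof (rule that)
  let ?M = "U \<inter> \<Inter>{A\<in>\<A>. x \<in> A}"
  show "x \<in> ?M" using assms by auto
  then show "?M \<in> intersection_semilattice U \<A>"
    unfolding intersection_semilattice_def by blast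
  show "?M \<subseteq> Y" if "Y \<in> intersection_semilattice U \<A>" "x \<in> Y" for Y
    using that unfolding intersection_semilattice_def by blast
qed

text \<open>The least flat through a point of the stratum of \<open>X\<close> is contained in
  \<open>X\<close>, and it cannot be smaller. Two flats whose strata share a point therefore both
  equal its least flat.\<close>

lemma disjoint_strata:
  "disjoint_family_on (stratum (intersection_semilattice U \<A>)) (intersection_semilattice U \<A>)"
proof -
  have "X = Y"
    if XY: "X \<in> intersection_semilattice U \<A>" "Y \<in> intersection_semilattice U \<A>"
      and x: "x \<in> stratum (intersection_semilattice U \<A>) X"
        "x \<in> stratum (intersection_semilattice U \<A>) Y" for X Y x
  proof -
    have "x \<in> U"
      using XY x by (auto simp: intersection_semilattice_def stratum_def)
    then obtain M where "M \<in> intersection_semilattice U \<A>" "x \<in> M"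
      "\<And>Y. Y \<in> intersection_semilattice U \<A> \<Longrightarrow> x \<in> Y \<Longrightarrow> M \<subseteq> Y"
      using intersection_semilattice_least by metis
    then show ?thesis
      using XY x unfolding stratum_def by blast
  qed
  then show ?thesis
    unfolding disjoint_family_on_def by blast
qed

text \<open>A point of \<open>X\<close> lies in the stratum of its least flat, and that flat is
  contained in \<open>X\<close>.\<close>

lemma Union_strata_below:
  assumes "X \<in> intersection_semilattice U \<A>"
  shows "X = (\<Union>Y\<in>{Y\<in>intersection_semilattice U \<A>. Y \<subseteq> X}.
                stratum (intersection_semilattice U \<A>) Y)"
proof
  show "X \<subseteq> (\<Union>Y\<in>{Y\<in>intersection_semilattice U \<A>. Y \<subseteq> X}.
                stratum (intersection_semilattice U \<A>) Y)"
  proof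
    fix x assume x: "x \<in> X"
    then have "x \<in> U"
      using assms by (auto simp: intersection_semilattice_def)
    then obtain M where M: "M \<in> intersection_semilattice U \<A>" "x \<in> M"
      "\<And>Y. Y \<in> intersection_semilattice U \<A> \<Longrightarrow> x \<in> Y \<Longrightarrow> M \<subseteq> Y"
      using intersection_semilattice_least by metis
    then have "x \<in> stratum (intersection_semilattice U \<A>) M"
      unfolding stratum_def by blast
    with M x assms show "x \<in> (\<Union>Y\<in>{Y\<in>intersection_semilattice U \<A>. Y \<subseteq> X}.
                stratum (intersection_semilattice U \<A>) Y)"
      by blast
  qed
qed (auto simp: stratum_def)

text \<open>A flat other than \<open>U\<close> comes from a nonempty subfamily and so lies inside
  some member. Conversely, a nonempty member is itself a flat, and it is strictly below
  \<open>U\<close> because \<open>U \<notin> \<A>\<close>.\<close>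

lemma stratum_top:
  assumes "\<Union>\<A> \<subseteq> U" "U \<notin> \<A>"
  shows "stratum (intersection_semilattice U \<A>) U = U - \<Union>\<A>"
proof -
  have "x \<in> \<Union>{Y\<in>intersection_semilattice U \<A>. Y \<subset> U} \<longleftrightarrow> x \<in> \<Union>\<A>" for x
  proof
    assume "x \<in> \<Union>{Y\<in>intersection_semilattice U \<A>. Y \<subset> U}"
    then obtain \<C> where "\<C> \<subseteq> \<A>" "x \<in> U \<inter> \<Inter>\<C>" "U \<inter> \<Inter>\<C> \<subset> U"
      unfolding intersection_semilattice_def by blast
    then show "x \<in> \<Union>\<A>"
      by blast
  next
    assume "x \<in> \<Union>\<A>"
    then obtain A where A: "A \<in> \<A>" "x \<in> A"
      by blast
    then have "A = U \<inter> \<Inter>{A}" "{A} \<subseteq> \<A>"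
      using assms by auto
    then have "A \<in> intersection_semilattice U \<A>"
      using A(2) unfolding intersection_semilattice_def by blast
    moreover have "A \<subset> U"
      using A assms by blast
    ultimately show "x \<in> \<Union>{Y\<in>intersection_semilattice U \<A>. Y \<subset> U}"
      using A by blast
  qed
  then show ?thesis
    unfolding stratum_def by blast
qed

text \<open>Moebius inversion for inclusion of flats, taken at \<open>U\<close>: \<open>g\<close> is
  \<open>v\<close> itself and \<open>f\<close> is the valuation of the stratum.\<close>

lemma valuation_complement_mobius:
  fixes v :: "'x set \<Rightarrow> 'r::comm_ring_1"
  assumes G: "\<Union>G \<subseteq> U" and v: "valuation_on (boolean_algebra_gen U G) v"
    and \<A>: "finite \<A>" "\<A> \<subseteq> G" "U \<notin> \<A>" and U: "U \<noteq> {}"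
  shows "v (U - \<Union>\<A>) = (\<Sum>X\<in>intersection_semilattice U \<A>.
                             of_int (mobius (intersection_semilattice U \<A>) X U) * v X)"
proof -
  define L where "L = intersection_semilattice U \<A>"
  have fin: "finite L"
    unfolding L_def using \<A>(1) by (rule finite_intersection_semilattice)
  have "U = U \<inter> \<Inter>{}"
    by simp
  then have "U \<in> L"
    using U unfolding L_def intersection_semilattice_def by blast
  have L_sub: "X \<subseteq> U" if "X \<in> L" for X
    using that by (auto simp: L_def intersection_semilattice_def)
  have L_alg: "L \<subseteq> boolean_algebra_gen U G"
  proof
    fix X assume "X \<in> L"
    then obtain \<C> where \<C>: "\<C> \<subseteq> \<A>" "X = U \<inter> \<Inter>\<C>"
      unfolding L_def intersection_semilattice_def by blast
    have "\<C> \<subseteq> boolean_algebra_gen U G"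
      using \<C>(1) \<A>(2) boolean_algebra_gen.gen by blast
    then show "X \<in> boolean_algebra_gen U G"
      unfolding \<C>(2) using boolean_algebra_gen_Inter[OF G] finite_subset[OF \<C>(1) \<A>(1)] by blast
  qed
  \<comment> \<open>The valuation identity is available only inside the generated algebra, so the
    strata have to be located there before additivity is applied.\<close>
  have strata: "stratum L X \<in> boolean_algebra_gen U G" if "X \<in> L" for X
    unfolding stratum_def
  proof (intro boolean_algebra_gen_Diff[OF G] boolean_algebra_gen_Union)
    show "X \<in> boolean_algebra_gen U G" "{Y\<in>L. Y \<subset> X} \<subseteq> boolean_algebra_gen U G"
      using that L_alg by blast+
  qed (use fin in simp)
  have "v X = (\<Sum>Y\<in>{Y\<in>L. Y \<le> X}. v (stratum L Y))" if "X \<in> L" for X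
  proof -
    have "disjoint_family_on (stratum L) {Y\<in>L. Y \<le> X}"
      unfolding L_def by (rule disjoint_family_on_mono[OF _ disjoint_strata]) auto
    then have "v (\<Union>Y\<in>{Y\<in>L. Y \<le> X}. stratum L Y) = (\<Sum>Y\<in>{Y\<in>L. Y \<le> X}. v (stratum L Y))"
      using fin strata by (intro valuation_disjoint_UN[OF v]) auto
    also have "(\<Union>Y\<in>{Y\<in>L. Y \<le> X}. stratum L Y) = X"
      using Union_strata_below[of X U \<A>] that unfolding L_def by simp
    finally show ?thesis .
  qed
  from mobius_inversion_above[where f = "\<lambda>X. v (stratum L X)", OF fin \<open>U \<in> L\<close> this]
  have "(\<Sum>X\<in>{X\<in>L. X \<le> U}. of_int (mobius L X U) * v X) = v (stratum L U)" .
  moreover have "{X\<in>L. X \<le> U} = L"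
    using L_sub by auto
  moreover have "stratum L U = U - \<Union>\<A>"
    unfolding L_def using G \<A> by (intro stratum_top) auto
  ultimately show ?thesis
    by (simp add: L_def)
qed

section \<open>Subgroups and cosets in the two settings\<close>

lemma admissible_factor_abelian_group:
  assumes "admissible_factors S n \<Omega>" "i \<in> {1..n}"
  shows "abelian_group (\<Omega> i)"
proof (cases S)
  case Groups
  then show ?thesis using assms by (simp add: fin_gen_abelian_group_def)
next
  case (Vector_Spaces K)
  then show ?thesis using assms by (auto simp: vectorspace_def module_def)
qed

lemma carrier_in_subgroups_of:
  assumes "admissible_factors S n \<Omega>" "i \<in> {1..n}"
  shows "carrier (\<Omega> i) \<in> subgroups_of S (\<Omega> i)"
proof (cases S)
  case Groups
  have "group (add_monoid (\<Omega> i))"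
    using admissible_factor_abelian_group[OF assms] by (rule abelian_group.a_group)
  then show ?thesis
    using Groups group.subgroup_self by fastforce
next
  case (Vector_Spaces K)
  then have vs: "vectorspace K (\<Omega> i)"
    using assms by simp
  then interpret vectorspace K "\<Omega> i" .
  have "submodule K (carrier (\<Omega> i)) (\<Omega> i)"
    by (intro submodule.intro) (auto intro: module_axioms)
  then show ?thesis
    using Vector_Spaces vs by (simp add: subspace_def)
qed

text \<open>Closure under negation comes from multiplication by the scalar -1.\<close>

lemma submodule_imp_add_subgroup:
  assumes "submodule R N M"
  shows "subgroup N (add_monoid M)"
proof -
  interpret submodule R N M by fact
  interpret module R M by (rule module)
  show ?thesis
  proof
    fix x assume x: "x \<in> N"
    then have "\<ominus>\<^bsub>M\<^esub> x = (\<ominus>\<^bsub>R\<^esub> \<one>\<^bsub>R\<^esub>) \<odot>\<^bsub>M\<^esub> x"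
      using subset by (simp add: smult_l_minus subsetD)
    then show "inv\<^bsub>add_monoid M\<^esub> x \<in> N"
      using x by (simp flip: a_inv_def)
  qed (use subset in auto)
qed

text \<open>Through this reduction the later arguments on cosets take place in the additive group,
  without a case distinction on the setting.\<close>

lemma subgroups_of_imp_subgroup:
  assumes "H \<in> subgroups_of S M"
  shows "subgroup H (add_monoid M)"
  using assms by (cases S) (auto simp: subspace_def intro: submodule_imp_add_subgroup)

lemma subgroups_of_subset:
  assumes "H \<in> subgroups_of S M"
  shows "H \<subseteq> carrier M"
  using subgroup.subset[OF subgroups_of_imp_subgroup[OF assms]] by simp

lemma subgroups_of_Int:
  assumes "abelian_group M" "H \<in> subgroups_of S M" "H' \<in> subgroups_of S M"
  shows "H \<inter> H' \<in> subgroups_of S M"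
proof (cases S)
  case Groups
  then show ?thesis
    using assms group.subgroups_Inter_pair[OF abelian_group.a_group] by auto
next
  case (Vector_Spaces K)
  have "submodule K (N \<inter> N') M" if "submodule K N M" "submodule K N' M" for N N'
    using that unfolding submodule_def by auto
  then show ?thesis
    using Vector_Spaces assms by (auto simp: subspace_def)
qed

lemma mem_a_r_coset_self:
  assumes "abelian_group M" "subgroup H (add_monoid M)" "x \<in> carrier M"
  shows "x \<in> H +>\<^bsub>M\<^esub> x"
  using group.rcos_self[OF abelian_group.a_group[OF assms(1)], of x H] assms(2,3)
  by (simp add: a_r_coset_def)

text \<open>Cancelling \<open>z\<close> shows that a common point comes from one and the same
  element of both subgroups.\<close>

lemma a_r_coset_Int:
  assumes "abelian_group M" "subgroup H (add_monoid M)" "subgroup H' (add_monoid M)" "z \<in> carrier M"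
  shows "(H +>\<^bsub>M\<^esub> z) \<inter> (H' +>\<^bsub>M\<^esub> z) = (H \<inter> H') +>\<^bsub>M\<^esub> z"
proof -
  interpret abelian_group M by fact
  have "H \<subseteq> carrier M" "H' \<subseteq> carrier M"
    using assms(2,3)[THEN subgroup.subset] by simp_all
  then show ?thesis
    using assms(4) by (auto simp: a_r_coset_def' subset_iff)
qed

lemma subgroups_of_subset_cosets_of:
  assumes "abelian_group M"
  shows "subgroups_of S M \<subseteq> cosets_of S M"
proof
  interpret abelian_group M by fact
  fix H assume H: "H \<in> subgroups_of S M"
  then have "H +>\<^bsub>M\<^esub> \<zero>\<^bsub>M\<^esub> = H"
    by (simp add: subgroups_of_subset)
  then show "H \<in> cosets_of S M"
    unfolding cosets_of_def using H zero_closed by blast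
qed

lemma cosets_of_nonempty_subset:
  assumes "abelian_group M" "C \<in> cosets_of S M"
  shows "C \<noteq> {}" "C \<subseteq> carrier M"
proof -
  obtain H x where C: "C = H +>\<^bsub>M\<^esub> x" "H \<in> subgroups_of S M" "x \<in> carrier M"
    using assms(2) by (auto simp: cosets_of_def)
  note H = subgroups_of_imp_subgroup[OF C(2)]
  show "C \<noteq> {}"
    using mem_a_r_coset_self[OF assms(1) H C(3)] C(1) by auto
  show "C \<subseteq> carrier M"
    using abelian_monoid.a_r_coset_subset_G[of M H x] abelian_group.axioms(1)[OF assms(1)]
      subgroup.subset[OF H] C by simp
qed

text \<open>Any common point represents both cosets, which reduces the claim to two cosets with the
  same representative.\<close>

lemma cosets_of_Int:
  assumes "abelian_group M" "C \<in> cosets_of S M" "D \<in> cosets_of S M" "C \<inter> D \<noteq> {}"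
  shows "C \<inter> D \<in> cosets_of S M"
proof -
  obtain H x where C: "C = H +>\<^bsub>M\<^esub> x" "H \<in> subgroups_of S M" "x \<in> carrier M"
    using assms(2) by (auto simp: cosets_of_def)
  obtain H' y where D: "D = H' +>\<^bsub>M\<^esub> y" "H' \<in> subgroups_of S M" "y \<in> carrier M"
    using assms(3) by (auto simp: cosets_of_def)
  note sub = subgroups_of_imp_subgroup[OF C(2)] subgroups_of_imp_subgroup[OF D(2)]
  obtain z where z: "z \<in> C" "z \<in> D"
    using assms(4) by auto
  have zM: "z \<in> carrier M"
    using cosets_of_nonempty_subset[OF assms(1,2)] z by auto
  have "C = H +>\<^bsub>M\<^esub> z" "D = H' +>\<^bsub>M\<^esub> z"
    using abelian_group.a_repr_independence[OF assms(1)] C D z sub by auto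
  then have "C \<inter> D = (H \<inter> H') +>\<^bsub>M\<^esub> z"
    using a_r_coset_Int[OF assms(1) sub zM] by simp
  then show ?thesis
    using subgroups_of_Int[OF assms(1) C(2) D(2)] zM by (auto simp: cosets_of_def)
qed

text \<open>A coset determines its subgroup, so the definite description in \<open>direction\<close>
  is well defined.\<close>

lemma direction_coset:
  assumes "abelian_group M" "H \<in> subgroups_of S M" "x \<in> carrier M"
  shows "direction S M (H +>\<^bsub>M\<^esub> x) = H"
  unfolding direction_def
proof (rule the_equality)
  show "H \<in> subgroups_of S M \<and> (\<exists>y\<in>carrier M. H +>\<^bsub>M\<^esub> x = H +>\<^bsub>M\<^esub> y)"
    using assms by auto
next
  interpret abelian_group M by fact
  fix H' assume "H' \<in> subgroups_of S M \<and> (\<exists>y\<in>carrier M. H +>\<^bsub>M\<^esub> x = H' +>\<^bsub>M\<^esub> y)"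
  then obtain y where H': "H' \<in> subgroups_of S M" and y: "y \<in> carrier M"
    and eq: "H +>\<^bsub>M\<^esub> x = H' +>\<^bsub>M\<^esub> y"
    by auto
  note sub = subgroups_of_imp_subgroup[OF assms(2)] subgroups_of_imp_subgroup[OF H']
  \<comment> \<open>The competing coset is rewritten with the representative \<open>x\<close>, so
    that only the subgroups can differ.\<close>
  have "x \<in> H' +>\<^bsub>M\<^esub> y"
    using mem_a_r_coset_self[OF assms(1) sub(1) assms(3)] eq by simp
  then have eq': "H +>\<^bsub>M\<^esub> x = H' +>\<^bsub>M\<^esub> x"
    using a_repr_independence[OF _ y sub(2)] eq by simp
  have "H \<subseteq> carrier M" "H' \<subseteq> carrier M"
    using assms(2) H' by (auto dest: subgroups_of_subset)
  then have "h \<in> H \<longleftrightarrow> h \<in> H'" if "h \<in> carrier M" for h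
  proof -
    \<comment> \<open>By cancellation, a subset of the carrier can be read off its translate by
      \<open>x\<close>.\<close>
    have "h \<in> N \<longleftrightarrow> h \<oplus>\<^bsub>M\<^esub> x \<in> N +>\<^bsub>M\<^esub> x" if "N \<subseteq> carrier M" for N
      using that \<open>h \<in> carrier M\<close> assms(3) by (auto simp: a_r_coset_def' subset_iff)
    then show ?thesis
      using eq' \<open>H \<subseteq> carrier M\<close> \<open>H' \<subseteq> carrier M\<close> by metis
  qed
  then show "H' = H"
    using \<open>H \<subseteq> carrier M\<close> \<open>H' \<subseteq> carrier M\<close> by auto
qed

section \<open>Products of cosets: intersections, translates, valuations\<close>

lemma coset_products_subset:
  assumes "admissible_factors S n \<Omega>"
  shows "\<Union>(coset_products S n \<Omega>) \<subseteq> carrier (total_group n \<Omega>)"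
proof -
  have "PiE {1..n} C \<subseteq> carrier (total_group n \<Omega>)"
    if "\<forall>i\<in>{1..n}. C i \<in> cosets_of S (\<Omega> i)" for C
  proof -
    have "PiE {1..n} C \<subseteq> PiE {1..n} (\<lambda>i. carrier (\<Omega> i))"
      using that
      by (intro PiE_mono cosets_of_nonempty_subset(2)[OF admissible_factor_abelian_group[OF assms]])
        blast+
    then show ?thesis
      by (simp add: total_group_def)
  qed
  then show ?thesis
    unfolding coset_products_def by blast
qed

lemma carrier_in_coset_products:
  assumes "admissible_factors S n \<Omega>"
  shows "carrier (total_group n \<Omega>) \<in> coset_products S n \<Omega>"
proof -
  have "carrier (\<Omega> i) \<in> cosets_of S (\<Omega> i)" if "i \<in> {1..n}" for i
    using subgroups_of_subset_cosets_of[OF admissible_factor_abelian_group[OF assms that]]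
      carrier_in_subgroups_of[OF assms that] by blast
  then have "PiE {1..n} (\<lambda>i. carrier (\<Omega> i)) \<in> coset_products S n \<Omega>"
    unfolding coset_products_def by blast
  then show ?thesis
    by (simp add: total_group_def)
qed

text \<open>Products intersect factor by factor, and a nonempty product has only nonempty factors,
  so each factor is again a coset.\<close>

lemma coset_products_Int:
  assumes "admissible_factors S n \<Omega>" "X \<in> coset_products S n \<Omega>" "Y \<in> coset_products S n \<Omega>"
    and "X \<inter> Y \<noteq> {}"
  shows "X \<inter> Y \<in> coset_products S n \<Omega>"
proof -
  obtain C D where C: "X = PiE {1..n} C" "\<forall>i\<in>{1..n}. C i \<in> cosets_of S (\<Omega> i)"
    and D: "Y = PiE {1..n} D" "\<forall>i\<in>{1..n}. D i \<in> cosets_of S (\<Omega> i)"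
    using assms(2,3) unfolding coset_products_def by auto
  have eq: "X \<inter> Y = PiE {1..n} (\<lambda>i. C i \<inter> D i)"
    using C D by (simp add: PiE_Int)
  moreover have "C i \<inter> D i \<in> cosets_of S (\<Omega> i)" if i: "i \<in> {1..n}" for i
  proof -
    have "C i \<inter> D i \<noteq> {}"
      using assms(4) i unfolding eq PiE_eq_empty_iff by blast
    then show ?thesis
      using C(2) D(2) i by (intro cosets_of_Int admissible_factor_abelian_group[OF assms(1) i]) blast+
  qed
  ultimately show ?thesis
    unfolding coset_products_def by blast
qed

lemma intersection_semilattice_coset_products:
  assumes "admissible_factors S n \<Omega>" "finite \<A>" "\<A> \<subseteq> coset_products S n \<Omega>"
  shows "intersection_semilattice (carrier (total_group n \<Omega>)) \<A> \<subseteq> coset_products S n \<Omega>"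
proof -
  let ?U = "carrier (total_group n \<Omega>)"
  have "?U \<inter> \<Inter>\<C> \<in> coset_products S n \<Omega>"
    if "finite \<C>" "\<C> \<subseteq> \<A>" "?U \<inter> \<Inter>\<C> \<noteq> {}" for \<C>
    using that
  proof induction
    case empty
    then show ?case using carrier_in_coset_products[OF assms(1)] by simp
  next
    case (insert A \<C>)
    have eq: "?U \<inter> \<Inter>(insert A \<C>) = A \<inter> (?U \<inter> \<Inter>\<C>)"
      by auto
    \<comment> \<open>The smaller intersection contains the nonempty larger one, so the induction
      hypothesis applies to it.\<close>
    have "?U \<inter> \<Inter>\<C> \<in> coset_products S n \<Omega>"
      using insert by auto
    show ?case
      unfolding eq
    proof (rule coset_products_Int[OF assms(1)])
      show "A \<in> coset_products S n \<Omega>"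
        using insert.prems(1) assms(3) by blast
      show "A \<inter> (?U \<inter> \<Inter>\<C>) \<noteq> {}"
        using insert.prems(2) unfolding eq .
    qed fact
  qed
  then show ?thesis
    using finite_subset[OF _ assms(2)] unfolding intersection_semilattice_def by blast
qed

text \<open>Translation acts coordinatewise, and commutativity turns the left translates of the
  product group into the right cosets used for the factors.\<close>

lemma l_coset_PiE_total_group:
  assumes "admissible_factors S n \<Omega>" "\<forall>i\<in>{1..n}. H i \<in> subgroups_of S (\<Omega> i)"
    and "x \<in> carrier (total_group n \<Omega>)"
  shows "x <#\<^bsub>total_group n \<Omega>\<^esub> PiE {1..n} H = PiE {1..n} (\<lambda>i. H i +>\<^bsub>\<Omega> i\<^esub> x i)"
proof
  have xi: "x i \<in> carrier (\<Omega> i)" if "i \<in> {1..n}" for i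
    using assms(3) that by (auto simp: total_group_def)
  have Hi: "H i \<subseteq> carrier (\<Omega> i)" if "i \<in> {1..n}" for i
    using assms(2) that by (blast dest: subgroups_of_subset)
  have comm: "x i \<oplus>\<^bsub>\<Omega> i\<^esub> h = h \<oplus>\<^bsub>\<Omega> i\<^esub> x i" if "i \<in> {1..n}" "h \<in> H i" for i h
  proof -
    interpret abelian_group "\<Omega> i"
      using admissible_factor_abelian_group[OF assms(1) that(1)] .
    show ?thesis
      using a_comm xi Hi that by blast
  qed
  have coset: "H i +>\<^bsub>\<Omega> i\<^esub> x i = (\<lambda>h. x i \<oplus>\<^bsub>\<Omega> i\<^esub> h) ` H i" if "i \<in> {1..n}" for i
    unfolding a_r_coset_def' image_def using comm[OF that] by auto
  show "x <#\<^bsub>total_group n \<Omega>\<^esub> PiE {1..n} H \<subseteq> PiE {1..n} (\<lambda>i. H i +>\<^bsub>\<Omega> i\<^esub> x i)"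
  proof
    fix y assume "y \<in> x <#\<^bsub>total_group n \<Omega>\<^esub> PiE {1..n} H"
    then obtain h where h: "h \<in> PiE {1..n} H" "y = x \<otimes>\<^bsub>total_group n \<Omega>\<^esub> h"
      unfolding l_coset_def by blast
    then have "y = (\<lambda>i\<in>{1..n}. x i \<oplus>\<^bsub>\<Omega> i\<^esub> h i)"
      by (simp add: total_group_def)
    moreover have "x i \<oplus>\<^bsub>\<Omega> i\<^esub> h i \<in> H i +>\<^bsub>\<Omega> i\<^esub> x i" if "i \<in> {1..n}" for i
      unfolding coset[OF that] using PiE_mem[OF h(1) that] by (rule imageI)
    ultimately show "y \<in> PiE {1..n} (\<lambda>i. H i +>\<^bsub>\<Omega> i\<^esub> x i)"
      by auto
  qed
  show "PiE {1..n} (\<lambda>i. H i +>\<^bsub>\<Omega> i\<^esub> x i) \<subseteq> x <#\<^bsub>total_group n \<Omega>\<^esub> PiE {1..n} H"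
  proof
    fix y assume y: "y \<in> PiE {1..n} (\<lambda>i. H i +>\<^bsub>\<Omega> i\<^esub> x i)"
    have "\<exists>h. h \<in> H i \<and> y i = x i \<oplus>\<^bsub>\<Omega> i\<^esub> h" if "i \<in> {1..n}" for i
      using PiE_mem[OF y that] unfolding coset[OF that] by blast
    then obtain h where h: "\<forall>i\<in>{1..n}. h i \<in> H i \<and> y i = x i \<oplus>\<^bsub>\<Omega> i\<^esub> h i"
      by metis
    \<comment> \<open>\<open>restrict\<close> makes the coordinatewise choice extensional, as
      elements of \<open>PiE\<close> have to be.\<close>
    then have "y = x \<otimes>\<^bsub>total_group n \<Omega>\<^esub> restrict h {1..n}"
      using y by (auto simp: total_group_def PiE_iff extensional_def)
    moreover have "restrict h {1..n} \<in> PiE {1..n} H"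
      using h by auto
    ultimately show "y \<in> x <#\<^bsub>total_group n \<Omega>\<^esub> PiE {1..n} H"
      unfolding l_coset_def by blast
  qed
qed

text \<open>Representatives chosen in all factors exhibit \<open>X\<close> as a translate of a
  product of subgroups. Translation invariance reduces \<open>v X\<close> to the prescribed value
  there, and these subgroups are the directions of the projections of \<open>X\<close>.\<close>

lemma char_valuation_coset_product:
  assumes adm: "admissible_factors S n \<Omega>" and v: "is_char_valuation S n \<Omega> v"
    and X: "X \<in> coset_products S n \<Omega>"
  shows "v X = weight S n \<Omega> (\<lambda>i. direction S (\<Omega> i) ((\<lambda>x. x i) ` X))"
proof -
  let ?G = "total_group n \<Omega>"
  obtain C where C: "X = PiE {1..n} C" "\<forall>i\<in>{1..n}. C i \<in> cosets_of S (\<Omega> i)"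
    using X unfolding coset_products_def by auto
  then have "\<forall>i\<in>{1..n}. \<exists>H x. H \<in> subgroups_of S (\<Omega> i) \<and> x \<in> carrier (\<Omega> i) \<and> C i = H +>\<^bsub>\<Omega> i\<^esub> x"
    unfolding cosets_of_def by blast
  then obtain H x where H: "\<forall>i\<in>{1..n}. H i \<in> subgroups_of S (\<Omega> i)"
    and x: "\<forall>i\<in>{1..n}. x i \<in> carrier (\<Omega> i)"
    and CH: "\<forall>i\<in>{1..n}. C i = H i +>\<^bsub>\<Omega> i\<^esub> x i"
    by metis
  have grp: "abelian_group (\<Omega> i)" if "i \<in> {1..n}" for i
    using admissible_factor_abelian_group[OF adm that] .
  have "C i \<noteq> {}" if "i \<in> {1..n}" for i
    using C(2) that by (intro cosets_of_nonempty_subset(1)[OF grp]) blast+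
  \<comment> \<open>The projections of a product are its factors only if the product is
    nonempty.\<close>
  then have "X \<noteq> {}"
    unfolding C(1) PiE_eq_empty_iff by blast
  then have proj: "(\<lambda>f. f i) ` X = C i" if "i \<in> {1..n}" for i
    using that C by (simp add: image_projection_PiE)
  have dir: "direction S (\<Omega> i) ((\<lambda>f. f i) ` X) = H i" if "i \<in> {1..n}" for i
    unfolding proj[OF that] bspec[OF CH that] using H x that by (intro direction_coset grp) blast+
  have xG: "restrict x {1..n} \<in> carrier ?G"
    using x by (auto simp: total_group_def)
  have "PiE {1..n} H \<in> coset_products S n \<Omega>"
    unfolding coset_products_def using H subgroups_of_subset_cosets_of[OF grp] by blast
  then have "v (restrict x {1..n} <#\<^bsub>?G\<^esub> PiE {1..n} H) = v (PiE {1..n} H)"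
    using v xG boolean_algebra_gen.gen
    unfolding is_char_valuation_def Let_def translation_invariant_on_def by metis
  moreover have "restrict x {1..n} <#\<^bsub>?G\<^esub> PiE {1..n} H = X"
    unfolding l_coset_PiE_total_group[OF adm H xG] C(1) using CH by (intro PiE_cong) auto
  moreover have "v (PiE {1..n} H) = weight S n \<Omega> H"
    using v H unfolding is_char_valuation_def Let_def by blast
  moreover have "weight S n \<Omega> H = weight S n \<Omega> (\<lambda>i. direction S (\<Omega> i) ((\<lambda>x. x i) ` X))"
    unfolding weight_def by (intro prod.cong) (use dir in auto)
  ultimately show ?thesis
    by simp
qed

text \<open>If \<Omega> were a member, the complement would be empty and have valuation 0, whereas
  the flats would be the same as without that member. For \<A> consisting of \<Omega> alone the
  polynomial is the weight of \<Omega>, which is nonzero.\<close>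

theorem theorem2p3:
  fixes S :: "('k, 'b) ring_scheme setting"
    and n :: nat
    and \<Omega> :: "nat \<Rightarrow> ('k, 'a, 'c) module_scheme"
    and val :: "(nat \<Rightarrow> 'a) set \<Rightarrow> rat_mpoly"
    and \<A> :: "(nat \<Rightarrow> 'a) set set"
  assumes "admissible_factors S n \<Omega>"
    and "is_char_valuation S n \<Omega> val"
    and "arrangement S n \<Omega> \<A>"
    and "carrier (total_group n \<Omega>) \<notin> \<A>"
  shows "char_polynomial S n \<Omega> \<A> = val (carrier (total_group n \<Omega>) - \<Union>\<A>)"
proof -
  let ?U = "carrier (total_group n \<Omega>)"
  let ?L = "intersection_semilattice ?U \<A>"
  have \<A>: "finite \<A>" "\<A> \<subseteq> coset_products S n \<Omega>"
    using assms(3) by (auto simp: arrangement_def)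
  \<comment> \<open>The empty set is excluded from the flats, so \<Omega> has to be nonempty to be
    the top flat.\<close>
  have "?U \<noteq> {}"
  proof -
    have "\<one>\<^bsub>total_group n \<Omega>\<^esub> \<in> ?U"
      unfolding total_group_def
      by (intro monoid.one_closed group.is_monoid product_group abelian_group.a_group
          admissible_factor_abelian_group[OF assms(1)])
    then show ?thesis
      by blast
  qed
  moreover have "valuation_on (boolean_algebra_gen ?U (coset_products S n \<Omega>)) val"
    using assms(2) by (simp add: is_char_valuation_def Let_def)
  ultimately have "val (?U - \<Union>\<A>) = (\<Sum>X\<in>?L. of_int (mobius ?L X ?U) * val X)"
    using coset_products_subset[OF assms(1)] \<A> assms(4) by (intro valuation_complement_mobius)
  \<comment> \<open>The sums agree term by term, since every flat is a product of cosets and its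
    valuation is the weight of its direction.\<close>
  also have "\<dots> = char_polynomial S n \<Omega> \<A>"
    unfolding char_polynomial_def Let_def
    using char_valuation_coset_product[OF assms(1,2)]
      intersection_semilattice_coset_products[OF assms(1) \<A>]
    by (intro sum.cong) auto
  finally show ?thesis by simp
qed

end
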